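(* Let $G=(V,E)$ be a clique star with $V = C_1\sqcup\dots\sqcup C_k\sqcup S$, let $(d_v)_{v\in V}$ be the numbers of states, and let $r\ge 1$. Then $$I_G^{(r)} = \sum_{j_S\in\mathcal{R}_S} I^{(r)}_{j_S,\,d_{C_1}\times\cdots\times d_{C_k}},$$ where each summand is regarded as (extended to) an ideal of $\mathbb{C}[p_i \mid i\in\mathcal{R}]$.
   Context: $G=(V,E)$ is a finite simple undirected graph; each $v\in V$ carries a positive integer $d_v$ (number of states). Write $[n]=\{1,\dots,n\}$; for $A\subseteq V$ let $\mathcal{R}_A=\prod_{v\in A}[d_v]$, $d_A=\prod_{v\in A}d_v$ (so $d_\emptyset=1$ and $\mathcal{R}_\emptyset$ is a singleton), $\mathcal{R}=\mathcal{R}_V$; for $i\in\mathcal{R}$, $i_A\in\mathcal{R}_A$ is its restriction to $A$. A clique is a (possibly empty) set of pairwise adjacent vertices; $\mathcal{C}(G)$ is the set of (inclusion-)maximal cliques. Clique star: $G$ is a clique star if it is a union of its maximal cliques $\widetilde C_1,\dots,\widetilde C_k$ and there is a (possibly empty) clique $S$ with $\widetilde C_i\cap\widetilde C_j=S$ for all $i\ne j$. Put $C_i=\widetilde C_i\setminus S$, so $V=C_1\sqcup\dots\sqcup C_k\sqcup S$. With $m=\sum_{C\in\mathcal{C}(G)}d_C$, the monomial map $\phi^G:\mathbb{C}^m\to\mathbb{C}^{|\mathcal{R}|}$ is $\phi^G_i(\theta)=\prod_{C\in\mathcal{C}(G)}\theta^{(C)}_{i_C}$, $i\in\mathcal{R}$.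 $I_G^{(r)}\subseteq\mathbb{C}[p_i\mid i\in\mathcal{R}]$ is the vanishing ideal of the $r$-th secant variety of the graphical model (without the normalization $\sum_i p_i=1$), i.e. the ideal of all polynomials vanishing on $\{x_1+\dots+x_r : x_1,\dots,x_r\in\phi^G(\mathbb{C}^m)\}$. For $j_S\in\mathcal{R}_S$, $I^{(r)}_{j_S,\,d_{C_1}\times\cdots\times d_{C_k}}$ is the vanishing ideal, in the polynomial ring in the variables $p_i$ with $i_S=j_S$, of the $r$-th secant variety of the independence model on $C_1,\dots,C_k$ (again without normalization): viewing $(p_i)_{i_S=j_S}$ as a $d_{C_1}\times\cdots\times d_{C_k}$ tensor with indices $(i_{C_1},\dots,i_{C_k})$, it is the ideal of all polynomials vanishing on the complex tensors of rank at most $r$. *)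

theory Defs
  imports
    Complex_Main
    "HOL-Library.FuncSet"
    "HOL-Library.Poly_Mapping"
    "HOL-Library.Set_Algebras"
    "HOL-Algebra.Ideal"
begin

section \<open>Polynomials in the variables \<open>p\<^sub>i\<close>\<close>

text \<open>
  A monomial is a finitely supported exponent function, a polynomial a finitely supported
  coefficient function on monomials; the ring operations are those of
  \<^theory>\<open>HOL-Library.Poly_Mapping\<close> (addition and convolution product).
  Sums of sets of polynomials are those of \<^theory>\<open>HOL-Library.Set_Algebras\<close>; for ideals
  \<open>I + J = {f + g | f g. f \<in> I \<and> g \<in> J}\<close> is the usual sum.
\<close>

type_synonym 'i cpoly = "('i \<Rightarrow>\<^sub>0 nat) \<Rightarrow>\<^sub>0 complex"

definition indets :: "'i cpoly \<Rightarrow> 'i set" where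
  "indets f = (\<Union>m\<in>Poly_Mapping.keys f. Poly_Mapping.keys m)"

definition eval_poly :: "('i \<Rightarrow> complex) \<Rightarrow> 'i cpoly \<Rightarrow> complex" where
  "eval_poly x f =
     (\<Sum>m\<in>Poly_Mapping.keys f. Poly_Mapping.lookup f m *
       (\<Prod>i\<in>Poly_Mapping.keys m. x i ^ Poly_Mapping.lookup m i))"

text \<open>The polynomial ring \<open>\<complex>[p\<^sub>i | i \<in> A]\<close>.\<close>

definition mpoly_ring :: "'i set \<Rightarrow> 'i cpoly ring" where
  "mpoly_ring A =
     \<lparr>carrier = {f. indets f \<subseteq> A}, mult = (*), one = 1, zero = 0, add = (+)\<rparr>"

definition vanishing_ideal :: "'i set \<Rightarrow> ('i \<Rightarrow> complex) set \<Rightarrow> 'i cpoly set" where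
  "vanishing_ideal A X = {f \<in> carrier (mpoly_ring A). \<forall>x\<in>X. eval_poly x f = 0}"

lemma cring_mpoly_ring: "cring (mpoly_ring A)"
proof (rule cringI)
  have closed_add: "indets (f + g) \<subseteq> A" if "indets f \<subseteq> A" "indets g \<subseteq> A" for f g :: "'a cpoly"
    using that keys_add[of f g] unfolding indets_def by blast
  have closed_mult: "indets (f * g) \<subseteq> A" if "indets f \<subseteq> A" "indets g \<subseteq> A" for f g :: "'a cpoly"
  proof -
    have "Poly_Mapping.keys m \<subseteq> A" if "m \<in> Poly_Mapping.keys (f * g)" for m
    proof -
      from that keys_mult[of f g] obtain a b where "a \<in> Poly_Mapping.keys f" "b \<in> Poly_Mapping.keys g" "m = a + b"
        by blast
      with \<open>indets f \<subseteq> A\<close> \<open>indets g \<subseteq> A\<close> keys_add[of a b] show ?thesis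
        unfolding indets_def by blast
    qed
    then show ?thesis
      unfolding indets_def by blast
  qed
  have closed_uminus: "indets (- f) \<subseteq> A" if "indets f \<subseteq> A" for f :: "'a cpoly"
    using that unfolding indets_def by simp
  show "abelian_group (mpoly_ring A)"
  proof (rule abelian_groupI)
    fix f assume "f \<in> carrier (mpoly_ring A)"
    then show "\<exists>g\<in>carrier (mpoly_ring A). g \<oplus>\<^bsub>mpoly_ring A\<^esub> f = \<zero>\<^bsub>mpoly_ring A\<^esub>"
      by (intro bexI[of _ "- f"]) (simp_all add: mpoly_ring_def closed_uminus)
  qed (simp_all add: mpoly_ring_def closed_add indets_def[of 0] algebra_simps)
  show "comm_monoid (mpoly_ring A)"
    by (rule comm_monoidI)
      (simp_all add: mpoly_ring_def closed_mult indets_def[of 1] algebra_simps)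
qed (simp add: mpoly_ring_def algebra_simps)


section \<open>Graphs and clique stars\<close>

definition simple_graph :: "'v set \<Rightarrow> 'v set set \<Rightarrow> bool" where
  "simple_graph V E \<longleftrightarrow> finite V \<and> (\<forall>e\<in>E. e \<subseteq> V \<and> card e = 2)"

definition clique :: "'v set \<Rightarrow> 'v set set \<Rightarrow> 'v set \<Rightarrow> bool" where
  "clique V E K \<longleftrightarrow> K \<subseteq> V \<and> (\<forall>u\<in>K. \<forall>v\<in>K. u \<noteq> v \<longrightarrow> {u, v} \<in> E)"

definition maximal_cliques :: "'v set \<Rightarrow> 'v set set \<Rightarrow> 'v set set" where
  "maximal_cliques V E = {K. clique V E K \<and> (\<forall>L. clique V E L \<longrightarrow> K \<subseteq> L \<longrightarrow> L = K)}"

text \<open>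
  \<open>K 1, \<dots>, K k\<close> enumerates the maximal cliques (written with a tilde in the literature) without
  repetition, and \<open>S\<close> is the common intersection of any two of them; the sets
  \<open>C\<^sub>i\<close> are \<open>K i - S\<close>.  For \<open>k = 1\<close> the set \<open>S\<close> may be any clique.
\<close>

definition clique_star ::
    "'v set \<Rightarrow> 'v set set \<Rightarrow> nat \<Rightarrow> (nat \<Rightarrow> 'v set) \<Rightarrow> 'v set \<Rightarrow> bool" where
  "clique_star V E k K S \<longleftrightarrow>
     bij_betw K {1..k} (maximal_cliques V E) \<and>
     V = (\<Union>i\<in>{1..k}. K i) \<and>
     E = (\<Union>i\<in>{1..k}. {e. e \<subseteq> K i \<and> card e = 2}) \<and>
     clique V E S \<and>
     (\<forall>i\<in>{1..k}. \<forall>j\<in>{1..k}. i \<noteq> j \<longrightarrow> K i \<inter> K j = S)"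


section \<open>Secants of the graphical model\<close>

definition states :: "('v \<Rightarrow> nat) \<Rightarrow> 'v set \<Rightarrow> ('v \<Rightarrow> nat) set" where
  "states d A = (\<Pi>\<^sub>E v\<in>A. {1..d v})"

text \<open>
  The parameters are \<open>\<theta> C j\<close> with \<open>C\<close> a maximal clique and \<open>j \<in> states d C\<close>.  Values of \<open>\<theta>\<close> at
  other arguments are never used, so the range of this map is the image of \<open>\<complex>\<^sup>m\<close>.
\<close>

definition graph_map ::
    "'v set \<Rightarrow> 'v set set \<Rightarrow> ('v \<Rightarrow> nat) \<Rightarrow>
     ('v set \<Rightarrow> ('v \<Rightarrow> nat) \<Rightarrow> complex) \<Rightarrow> ('v \<Rightarrow> nat) \<Rightarrow> complex" where
  "graph_map V E d \<theta> =
     (\<lambda>i\<in>states d V. \<Prod>C\<in>maximal_cliques V E. \<theta> C (restrict i C))"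

definition graph_secant_ideal ::
    "'v set \<Rightarrow> 'v set set \<Rightarrow> ('v \<Rightarrow> nat) \<Rightarrow> nat \<Rightarrow> ('v \<Rightarrow> nat) cpoly set" where
  "graph_secant_ideal V E d r =
     vanishing_ideal (states d V)
       {\<lambda>i\<in>states d V. \<Sum>l<r. x l i | x. \<forall>l<r. x l \<in> range (graph_map V E d)}"


section \<open>Secants of the independence model\<close>

text \<open>
  A tensor with \<open>k\<close> modes, whose \<open>s\<close>-th index ranges over \<open>J s\<close>, is given by its entries at
  \<open>i \<in> (\<Pi>\<^sub>E s\<in>{1..k}. J s)\<close>.  The rank is the least number of product tensors summing to it;
  admitting zero summands does not change this minimum.
\<close>

definition tensor_rank ::
    "nat \<Rightarrow> (nat \<Rightarrow> 'i set) \<Rightarrow> ((nat \<Rightarrow> 'i) \<Rightarrow> complex) \<Rightarrow> nat" where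
  "tensor_rank k J T =
     (LEAST n. \<exists>a. \<forall>i\<in>(\<Pi>\<^sub>E s\<in>{1..k}. J s). T i = (\<Sum>l<n. \<Prod>s=1..k. a l s (i s)))"

definition slice :: "'v set \<Rightarrow> ('v \<Rightarrow> nat) \<Rightarrow> 'v set \<Rightarrow> ('v \<Rightarrow> nat) \<Rightarrow> ('v \<Rightarrow> nat) set" where
  "slice V d S j = {i \<in> states d V. restrict i S = j}"

text \<open>
  The vanishing ideal in \<open>\<complex>[p\<^sub>i | i\<^sub>S = j]\<close>, where \<open>i\<close> is identified with the
  tensor index \<open>(i\<^bsub>C\<^sub>1\<^esub>, \<dots>, i\<^bsub>C\<^sub>k\<^esub>)\<close>.
\<close>

definition independence_secant_ideal ::
    "'v set \<Rightarrow> ('v \<Rightarrow> nat) \<Rightarrow> nat \<Rightarrow> (nat \<Rightarrow> 'v set) \<Rightarrow> 'v set \<Rightarrow> nat \<Rightarrow> ('v \<Rightarrow> nat) \<Rightarrow>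
     ('v \<Rightarrow> nat) cpoly set" where
  "independence_secant_ideal V d k C S r j =
     vanishing_ideal (slice V d S j)
       {\<lambda>i\<in>slice V d S j. T (\<lambda>s\<in>{1..k}. restrict i (C s)) | T.
          tensor_rank k (\<lambda>s. states d (C s)) T \<le> r}"

end

theory Submission
  imports Defs
begin

text \<open>
  Fix the restriction \<open>j\<close> of a state \<open>i\<close> to the core \<open>S\<close>.  Every maximal clique contains \<open>S\<close>, so the
  parameters of the graphical model that enter the coordinates of the slice \<open>i\<^sub>S = j\<close> are
  those whose index restricts to \<open>j\<close>.  Different slices therefore use disjoint sets of
  parameters, and within one slice the map is the parametrization of rank-one tensors.  Hence the
  set of sums of \<open>r\<close> points of the model is, slice by slice, an arbitrary choice of tensors of rank
  at most \<open>r\<close>: it is a cartesian product indexed by the states of \<open>S\<close>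
  (\<open>rank_le_slices_imp_graph_secant\<close> and \<open>graph_secant_slice_rank_le\<close>).

  It remains to see that the vanishing ideal of a product of point sets is generated by the vanishing
  ideals of the factors (\<open>vanishing_ideal_product_subset\<close>).  This is the injectivity of
  \<open>F(X) \<otimes> F(Y) \<rightarrow> F(X \<times> Y)\<close> for spaces of functions over a field, in the following elementary form
  (\<open>bilinear_vanishing_in_ideal\<close>).  Write a polynomial vanishing on \<open>X \<times> Y\<close> as a sum
  of products \<open>g\<^sub>t h\<^sub>t\<close> that separate the two groups of variables, and pick one index \<open>t\<close>.  Either \<open>g\<^sub>t\<close>
  vanishes on \<open>X\<close>, and \<open>g\<^sub>t h\<^sub>t\<close> is in the ideal; or \<open>g\<^sub>t\<close> is nonzero at a point \<open>x\<^sub>0 \<in> X\<close>, and fixing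
  \<open>x = x\<^sub>0\<close> expresses \<open>h\<^sub>t\<close>, modulo the ideal of \<open>Y\<close>, as a combination of the other factors \<open>h\<^sub>s\<close>.  Both
  cases remove a summand.
\<close>

section \<open>Evaluation of polynomials\<close>

lemma poly_mapping_sum_monomials:
  fixes f :: "'a \<Rightarrow>\<^sub>0 'b :: comm_monoid_add"
  shows "(\<Sum>m\<in>Poly_Mapping.keys f. Poly_Mapping.single m (Poly_Mapping.lookup f m)) = f"
  by (rule poly_mapping_eqI)
    (simp add: Poly_Mapping.lookup_sum lookup_single when_def in_keys_iff)

definition monom_value :: "('i \<Rightarrow> complex) \<Rightarrow> ('i \<Rightarrow>\<^sub>0 nat) \<Rightarrow> complex" where
  "monom_value x m = (\<Prod>i\<in>Poly_Mapping.keys m. x i ^ Poly_Mapping.lookup m i)"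

lemma monom_value_superset:
  assumes "finite B" "Poly_Mapping.keys m \<subseteq> B"
  shows "monom_value x m = (\<Prod>i\<in>B. x i ^ Poly_Mapping.lookup m i)"
  unfolding monom_value_def
  by (rule prod.mono_neutral_left) (use assms in \<open>auto simp: in_keys_iff\<close>)

lemma monom_value_add: "monom_value x (m + n) = monom_value x m * monom_value x n"
proof -
  let ?B = "Poly_Mapping.keys m \<union> Poly_Mapping.keys n"
  show ?thesis
    using keys_add[of m n]
    by (simp add: monom_value_superset[of ?B] lookup_add power_add prod.distrib)
qed

lemma eval_poly_superset:
  assumes "finite B" "Poly_Mapping.keys f \<subseteq> B"
  shows "eval_poly x f = (\<Sum>m\<in>B. Poly_Mapping.lookup f m * monom_value x m)"
  unfolding eval_poly_def monom_value_def[symmetric]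
  by (rule sum.mono_neutral_left) (use assms in \<open>auto simp: in_keys_iff\<close>)

lemma eval_poly_add: "eval_poly x (f + g) = eval_poly x f + eval_poly x g"
proof -
  let ?B = "Poly_Mapping.keys f \<union> Poly_Mapping.keys g"
  show ?thesis
    using keys_add[of f g]
    by (simp add: eval_poly_superset[of ?B] lookup_add distrib_right sum.distrib)
qed

lemma eval_poly_0: "eval_poly x 0 = 0"
  by (simp add: eval_poly_def)

lemma eval_poly_sum: "eval_poly x (\<Sum>t\<in>T. f t) = (\<Sum>t\<in>T. eval_poly x (f t))"
  by (induction T rule: infinite_finite_induct) (simp_all add: eval_poly_0 eval_poly_add)

lemma eval_poly_single: "eval_poly x (Poly_Mapping.single m c) = c * monom_value x m"
  by (subst eval_poly_superset[of "{m}"]) simp_all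

lemma eval_poly_mult: "eval_poly x (f * g) = eval_poly x f * eval_poly x g"
proof -
  let ?F = "\<lambda>f m. Poly_Mapping.single m (Poly_Mapping.lookup f m)"
  have "f * g = (\<Sum>m\<in>Poly_Mapping.keys f. ?F f m) * (\<Sum>n\<in>Poly_Mapping.keys g. ?F g n)"
    by (simp add: poly_mapping_sum_monomials)
  also have "\<dots> = (\<Sum>m\<in>Poly_Mapping.keys f. \<Sum>n\<in>Poly_Mapping.keys g.
      Poly_Mapping.single (m + n) (Poly_Mapping.lookup f m * Poly_Mapping.lookup g n))"
    by (simp add: sum_product mult_single)
  finally have "eval_poly x (f * g) =
      (\<Sum>m\<in>Poly_Mapping.keys f. \<Sum>n\<in>Poly_Mapping.keys g.
        (Poly_Mapping.lookup f m * monom_value x m) * (Poly_Mapping.lookup g n * monom_value x n))"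
    by (simp add: eval_poly_sum eval_poly_single monom_value_add mult_ac)
  then show ?thesis
    by (simp add: eval_poly_def monom_value_def sum_product)
qed

lemma eval_poly_cong:
  assumes "\<And>i. i \<in> indets f \<Longrightarrow> x i = y i"
  shows "eval_poly x f = eval_poly y f"
  unfolding eval_poly_def
proof (rule sum.cong[OF refl])
  fix m assume "m \<in> Poly_Mapping.keys f"
  then have "(\<Prod>i\<in>Poly_Mapping.keys m. x i ^ Poly_Mapping.lookup m i) =
      (\<Prod>i\<in>Poly_Mapping.keys m. y i ^ Poly_Mapping.lookup m i)"
    by (intro prod.cong refl arg_cong[where f = "\<lambda>z. z ^ _"] assms) (auto simp: indets_def)
  then show "Poly_Mapping.lookup f m * (\<Prod>i\<in>Poly_Mapping.keys m. x i ^ Poly_Mapping.lookup m i) =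
      Poly_Mapping.lookup f m * (\<Prod>i\<in>Poly_Mapping.keys m. y i ^ Poly_Mapping.lookup m i)"
    by simp
qed

section \<open>Ideals of polynomial rings\<close>

lemma ring_mpoly_ring: "ring (mpoly_ring A)"
  by (rule cring.axioms(1)[OF cring_mpoly_ring])

lemma indets_add_subset:
  "indets f \<subseteq> A \<Longrightarrow> indets g \<subseteq> A \<Longrightarrow> indets (f + g) \<subseteq> A"
  using ring.ring_simprules(1)[OF ring_mpoly_ring[of A], of f g] by (simp add: mpoly_ring_def)

lemma indets_mult_subset:
  "indets f \<subseteq> A \<Longrightarrow> indets g \<subseteq> A \<Longrightarrow> indets (f * g) \<subseteq> A"
  using ring.ring_simprules(5)[OF ring_mpoly_ring[of A], of f g] by (simp add: mpoly_ring_def)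

lemma indets_0: "indets 0 = {}"
  by (simp add: indets_def)

lemma indets_sum_subset:
  "(\<And>t. t \<in> T \<Longrightarrow> indets (f t) \<subseteq> A) \<Longrightarrow> indets (\<Sum>t\<in>T. f t) \<subseteq> A"
  by (induction T rule: infinite_finite_induct) (simp_all add: indets_0 indets_add_subset)

lemma indets_single_subset: "indets (Poly_Mapping.single m c) \<subseteq> Poly_Mapping.keys m"
  by (simp add: indets_def)

lemma indets_const_subset: "indets (Poly_Mapping.single 0 c) \<subseteq> A"
  by (simp add: indets_def)

lemma carrier_mpoly_ring: "f \<in> carrier (mpoly_ring A) \<longleftrightarrow> indets f \<subseteq> A"
  by (simp add: mpoly_ring_def)

context
  fixes Q :: "'i cpoly set" and U :: "'i set"
  assumes ideal: "ideal Q (mpoly_ring U)"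
begin

lemma ideal_0: "0 \<in> Q"
  using additive_subgroup.zero_closed[OF ideal.axioms(1)[OF ideal]] by (simp add: mpoly_ring_def)

lemma ideal_add: "f \<in> Q \<Longrightarrow> g \<in> Q \<Longrightarrow> f + g \<in> Q"
  using additive_subgroup.a_closed[OF ideal.axioms(1)[OF ideal], of f g]
  by (simp add: mpoly_ring_def)

lemma ideal_mult: "indets h \<subseteq> U \<Longrightarrow> f \<in> Q \<Longrightarrow> h * f \<in> Q"
  using ideal.I_l_closed[OF ideal, of f h] by (simp add: mpoly_ring_def)

end

lemma vanishing_ideal_iff:
  "f \<in> vanishing_ideal A X \<longleftrightarrow> indets f \<subseteq> A \<and> (\<forall>x\<in>X. eval_poly x f = 0)"
  by (simp add: vanishing_ideal_def carrier_mpoly_ring)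

lemma uminus_mpoly_ring:
  assumes "indets f \<subseteq> A"
  shows "\<ominus>\<^bsub>mpoly_ring A\<^esub> f = - f"
proof -
  interpret R: cring "mpoly_ring A" by (rule cring_mpoly_ring)
  show ?thesis
    by (rule R.minus_equality) (use assms in \<open>simp_all add: mpoly_ring_def indets_def\<close>)
qed

lemma eval_poly_uminus: "eval_poly x (- f) = - eval_poly x f"
  using eval_poly_add[of x f "- f"] by (simp add: eval_poly_0 eq_neg_iff_add_eq_0 add.commute)

lemma ideal_vanishing_ideal: "ideal (vanishing_ideal A X) (mpoly_ring A)"
proof (rule idealI[OF ring_mpoly_ring])
  interpret R: cring "mpoly_ring A" by (rule cring_mpoly_ring)
  show "subgroup (vanishing_ideal A X) (add_monoid (mpoly_ring A))"
  proof (rule R.add.subgroupI)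
    show "vanishing_ideal A X \<subseteq> carrier (mpoly_ring A)"
      by (auto simp: vanishing_ideal_def)
    have "0 \<in> vanishing_ideal A X"
      by (simp add: vanishing_ideal_iff indets_0 eval_poly_0)
    then show "vanishing_ideal A X \<noteq> {}" by blast
  next
    fix f assume f: "f \<in> vanishing_ideal A X"
    then have "indets f \<subseteq> A" by (simp add: vanishing_ideal_iff)
    then have "\<ominus>\<^bsub>mpoly_ring A\<^esub> f = - f" by (rule uminus_mpoly_ring)
    then show "\<ominus>\<^bsub>mpoly_ring A\<^esub> f \<in> vanishing_ideal A X"
      using f by (simp add: vanishing_ideal_iff eval_poly_uminus) (simp add: indets_def)
  next
    fix f g assume "f \<in> vanishing_ideal A X" "g \<in> vanishing_ideal A X"
    then have "f + g \<in> vanishing_ideal A X"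
      by (simp add: vanishing_ideal_iff eval_poly_add indets_add_subset)
    then show "f \<oplus>\<^bsub>mpoly_ring A\<^esub> g \<in> vanishing_ideal A X"
      by (simp add: mpoly_ring_def)
  qed
next
  fix f g assume "f \<in> vanishing_ideal A X" "g \<in> carrier (mpoly_ring A)"
  then have "g * f \<in> vanishing_ideal A X"
    by (simp add: vanishing_ideal_iff eval_poly_mult indets_mult_subset carrier_mpoly_ring)
  then show "g \<otimes>\<^bsub>mpoly_ring A\<^esub> f \<in> vanishing_ideal A X" "f \<otimes>\<^bsub>mpoly_ring A\<^esub> g \<in> vanishing_ideal A X"
    by (simp_all add: mpoly_ring_def mult.commute)
qed

lemma ideal_sum_ideals:
  fixes P :: "'j \<Rightarrow> 'i cpoly set"
  assumes "finite J" "\<And>j. j \<in> J \<Longrightarrow> ideal (P j) (mpoly_ring A)"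
  shows "ideal (\<Sum>j\<in>J. P j) (mpoly_ring A)"
  using assms
proof (induction J rule: finite_induct)
  case empty
  have "(0 :: 'i cpoly set) = {\<zero>\<^bsub>mpoly_ring A\<^esub>}"
    by (simp add: mpoly_ring_def)
  then show ?case
    using ring.zeroideal[OF ring_mpoly_ring[of A]] by simp
next
  case (insert j J)
  have "P j + (\<Sum>j\<in>J. P j) = P j <+>\<^bsub>mpoly_ring A\<^esub> (\<Sum>j\<in>J. P j)"
    by (auto simp: set_plus_def set_add_def set_mult_def mpoly_ring_def)
  then show ?case
    using ring.add_ideals[OF ring_mpoly_ring, of "P j" A "\<Sum>j\<in>J. P j"] insert by simp
qed

lemma summand_subset_sum_ideals:
  assumes "finite J" "\<And>j. j \<in> J \<Longrightarrow> ideal (P j) (mpoly_ring A)" "j \<in> J"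
  shows "P j \<subseteq> (\<Sum>j\<in>J. P j)"
proof
  fix f assume "f \<in> P j"
  have "0 \<in> (\<Sum>j\<in>J - {j}. P j)"
    by (rule ideal_0[OF ideal_sum_ideals]) (use assms in auto)
  with \<open>f \<in> P j\<close> have "f + 0 \<in> P j + (\<Sum>j\<in>J - {j}. P j)"
    by (rule set_plus_intro)
  then show "f \<in> (\<Sum>j\<in>J. P j)"
    using sum.remove[of J j P] assms by simp
qed

lemma sum_ideals_subset:
  assumes "finite J" "ideal Q (mpoly_ring A)" "\<And>j. j \<in> J \<Longrightarrow> P j \<subseteq> Q"
  shows "(\<Sum>j\<in>J. P j) \<subseteq> Q"
  using assms(1,3)
proof (induction J rule: finite_induct)
  case empty
  then show ?case using ideal_0[OF assms(2)] by simp
next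
  case (insert j J)
  then show ?case
    by (auto simp: elim!: set_plus_elim intro!: ideal_add[OF assms(2)])
qed

section \<open>Vanishing ideals of products of point sets\<close>

text \<open>
  The induction eliminates one summand \<open>g t * h t\<close> at a time.  It runs over all families \<open>g\<close>, because
  replacing \<open>h t\<close> by a combination of the remaining \<open>h s\<close> changes their cofactors.
\<close>

lemma bilinear_vanishing_in_ideal:
  assumes Q: "ideal Q (mpoly_ring U)" and U: "A \<subseteq> U" "B \<subseteq> U"
    and X: "vanishing_ideal A X \<subseteq> Q" and Y: "vanishing_ideal B Y \<subseteq> Q"
    and "finite T" "\<And>t. t \<in> T \<Longrightarrow> indets (g t) \<subseteq> A" "\<And>t. t \<in> T \<Longrightarrow> indets (h t) \<subseteq> B"
    and "\<And>x y. x \<in> X \<Longrightarrow> y \<in> Y \<Longrightarrow> (\<Sum>t\<in>T. eval_poly x (g t) * eval_poly y (h t)) = 0"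
  shows "(\<Sum>t\<in>T. g t * h t) \<in> Q"
  using assms(6-)
proof (induction T arbitrary: g rule: finite_induct)
  case empty
  then show ?case using ideal_0[OF Q] by simp
next
  case (insert t T)
  have ind: "indets (g t) \<subseteq> A" "indets (h t) \<subseteq> B"
    "\<And>s. s \<in> T \<Longrightarrow> indets (g s) \<subseteq> A" "\<And>s. s \<in> T \<Longrightarrow> indets (h s) \<subseteq> B"
    using insert.prems by auto
  have van: "eval_poly x (g t) * eval_poly y (h t) +
      (\<Sum>s\<in>T. eval_poly x (g s) * eval_poly y (h s)) = 0" if "x \<in> X" "y \<in> Y" for x y
    using insert.prems(3)[OF that] insert.hyps by simp
  show ?case
  proof (cases "\<forall>x\<in>X. eval_poly x (g t) = 0")
    case True
    then have "g t \<in> Q"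
      using X ind by (auto simp: vanishing_ideal_iff)
    then have "g t * h t \<in> Q"
      using ideal_mult[OF Q, of "h t" "g t"] ind U by (simp add: mult.commute)
    moreover have "(\<Sum>s\<in>T. g s * h s) \<in> Q"
      by (rule insert.IH) (use ind van True in auto)
    ultimately show ?thesis
      using insert.hyps by (simp add: ideal_add[OF Q])
  next
    case False
    then obtain x0 where x0: "x0 \<in> X" "eval_poly x0 (g t) \<noteq> 0" by blast
    \<comment> \<open>The given identity at \<open>x0\<close>, divided by the value of \<open>g t\<close>, says that \<open>q\<close> vanishes on \<open>Y\<close>.  Solving
      for \<open>h t\<close> changes each remaining cofactor \<open>g s\<close> into \<open>g' s\<close>.\<close>
    define e where "e s = eval_poly x0 (g s) / eval_poly x0 (g t)" for s
    define q where "q = h t + (\<Sum>s\<in>T. Poly_Mapping.single 0 (e s) * h s)"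
    define g' where "g' s = g s + Poly_Mapping.single 0 (- e s) * g t" for s
    have eval_q: "eval_poly y q = eval_poly y (h t) + (\<Sum>s\<in>T. e s * eval_poly y (h s))" for y
      by (simp add: q_def eval_poly_add eval_poly_sum eval_poly_mult eval_poly_single monom_value_def)
    have "eval_poly y q = 0" if "y \<in> Y" for y
    proof -
      have "eval_poly x0 (g t) * eval_poly y q =
          eval_poly x0 (g t) * eval_poly y (h t) + (\<Sum>s\<in>T. eval_poly x0 (g s) * eval_poly y (h s))"
        using x0 by (simp add: eval_q e_def distrib_left sum_distrib_left)
      then show ?thesis
        using van[OF x0(1) that] x0 by simp
    qed
    moreover have "indets q \<subseteq> B"
      unfolding q_def
      by (intro indets_add_subset indets_sum_subset indets_mult_subset indets_const_subset ind)
    ultimately have q: "q \<in> vanishing_ideal B Y"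
      by (simp add: vanishing_ideal_iff)
    then have "g t * q \<in> Q"
      using ideal_mult[OF Q, of "g t" q] ind U Y by auto
    moreover have "(\<Sum>s\<in>T. g' s * h s) \<in> Q"
    proof (rule insert.IH)
      fix x y assume xy: "x \<in> X" "y \<in> Y"
      have "(\<Sum>s\<in>T. eval_poly x (g' s) * eval_poly y (h s)) =
          (\<Sum>s\<in>T. eval_poly x (g s) * eval_poly y (h s)) -
            eval_poly x (g t) * (\<Sum>s\<in>T. e s * eval_poly y (h s))"
        by (simp add: g'_def eval_poly_add eval_poly_mult eval_poly_single monom_value_def
            algebra_simps sum_subtractf sum_distrib_left)
      moreover have "(\<Sum>s\<in>T. e s * eval_poly y (h s)) = - eval_poly y (h t)"
        using q xy eval_q[of y] by (simp add: vanishing_ideal_iff eq_neg_iff_add_eq_0 add.commute)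
      ultimately show "(\<Sum>s\<in>T. eval_poly x (g' s) * eval_poly y (h s)) = 0"
        using van[OF xy] by (simp add: add.commute)
    next
      show "indets (g' s) \<subseteq> A" if "s \<in> T" for s
        unfolding g'_def using that
        by (intro indets_add_subset indets_mult_subset indets_const_subset ind)
    qed (use ind in auto)
    moreover have "(\<Sum>s\<in>insert t T. g s * h s) = g t * q + (\<Sum>s\<in>T. g' s * h s)"
    proof -
      have "g t * (Poly_Mapping.single 0 (e s) * h s) + g' s * h s = g s * h s" for s
        by (simp add: g'_def single_uminus algebra_simps)
      then show ?thesis
        using insert.hyps
        by (simp add: q_def distrib_left sum_distrib_left add.assoc flip: sum.distrib)
    qed
    ultimately show ?thesis
      by (simp add: ideal_add[OF Q])
  qed
qed

lemma monomial_split: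
  fixes m :: "'i \<Rightarrow>\<^sub>0 nat"
  assumes "Poly_Mapping.keys m \<subseteq> A \<union> B"
  obtains a b where "m = a + b" "Poly_Mapping.keys a \<subseteq> A" "Poly_Mapping.keys b \<subseteq> B"
proof
  let ?part = "\<lambda>I. \<Sum>i\<in>I. Poly_Mapping.single i (Poly_Mapping.lookup m i)"
  show "m = ?part (Poly_Mapping.keys m \<inter> A) + ?part (Poly_Mapping.keys m - A)"
    by (subst sum.Int_Diff[symmetric]) (simp_all add: poly_mapping_sum_monomials)
  show "Poly_Mapping.keys (?part (Poly_Mapping.keys m \<inter> A)) \<subseteq> A"
    by (rule order.trans[OF Poly_Mapping.keys_sum]) (auto split: if_splits)
  show "Poly_Mapping.keys (?part (Poly_Mapping.keys m - A)) \<subseteq> B"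
    by (rule order.trans[OF Poly_Mapping.keys_sum]) (use assms in \<open>auto split: if_splits\<close>)
qed

text \<open>
  The products \<open>g m * h m\<close> required by the preceding lemma are the terms of \<open>f\<close>, each monomial being
  split into its parts in \<open>A\<close> and in \<open>B\<close>.
\<close>

lemma vanishing_on_product_in_ideal:
  assumes Q: "ideal Q (mpoly_ring U)" and U: "A \<subseteq> U" "B \<subseteq> U" and disj: "A \<inter> B = {}"
    and X: "vanishing_ideal A X \<subseteq> Q" and Y: "vanishing_ideal B Y \<subseteq> Q"
    and f: "indets f \<subseteq> A \<union> B"
    and van: "\<And>x y. x \<in> X \<Longrightarrow> y \<in> Y \<Longrightarrow> eval_poly (\<lambda>i. if i \<in> A then x i else y i) f = 0"
  shows "f \<in> Q"
proof -
  have "\<exists>a b. m = a + b \<and> Poly_Mapping.keys a \<subseteq> A \<and> Poly_Mapping.keys b \<subseteq> B"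
    if "m \<in> Poly_Mapping.keys f" for m
    by (rule monomial_split[of m A B]) (use f that in \<open>auto simp: indets_def\<close>)
  then obtain a b where ab: "\<And>m. m \<in> Poly_Mapping.keys f \<Longrightarrow>
      m = a m + b m \<and> Poly_Mapping.keys (a m) \<subseteq> A \<and> Poly_Mapping.keys (b m) \<subseteq> B"
    by metis
  define g where "g m = Poly_Mapping.single (a m) (Poly_Mapping.lookup f m)" for m
  define h where "h m = Poly_Mapping.single (b m) (1 :: complex)" for m
  have g: "indets (g m) \<subseteq> A" and h: "indets (h m) \<subseteq> B" if "m \<in> Poly_Mapping.keys f" for m
    using ab[OF that] indets_single_subset unfolding g_def h_def by fast+
  have "g m * h m = Poly_Mapping.single m (Poly_Mapping.lookup f m)"
    if "m \<in> Poly_Mapping.keys f" for m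
    using ab[OF that] by (simp add: g_def h_def mult_single)
  then have fgh: "f = (\<Sum>m\<in>Poly_Mapping.keys f. g m * h m)"
    by (simp add: poly_mapping_sum_monomials)
  also have "\<dots> \<in> Q"
  proof (rule bilinear_vanishing_in_ideal[OF Q U X Y])
    fix x y assume xy: "x \<in> X" "y \<in> Y"
    let ?z = "\<lambda>i. if i \<in> A then x i else y i"
    have "eval_poly x (g m) * eval_poly y (h m) = eval_poly ?z (g m * h m)"
      if "m \<in> Poly_Mapping.keys f" for m
    proof -
      have "eval_poly x (g m) = eval_poly ?z (g m)"
        by (rule eval_poly_cong) (use g[OF that] in auto)
      moreover have "eval_poly y (h m) = eval_poly ?z (h m)"
        by (rule eval_poly_cong) (use h[OF that] disj in auto)
      ultimately show ?thesis
        by (simp add: eval_poly_mult)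
    qed
    then have "(\<Sum>m\<in>Poly_Mapping.keys f. eval_poly x (g m) * eval_poly y (h m)) =
        eval_poly ?z (\<Sum>m\<in>Poly_Mapping.keys f. g m * h m)"
      by (simp add: eval_poly_sum)
    then show "(\<Sum>m\<in>Poly_Mapping.keys f. eval_poly x (g m) * eval_poly y (h m)) = 0"
      using van[OF xy] fgh by simp
  qed (use g h in auto)
  finally show ?thesis .
qed

text \<open>
  Stated for an arbitrary ideal \<open>Q\<close> of an ambient ring, the inclusion can be proved by adding one
  block of variables at a time: \<open>Q\<close> and its ring stay the same throughout the induction.
\<close>

lemma vanishing_ideal_product_subset:
  assumes Q: "ideal Q (mpoly_ring U)" and "finite J"
    and "\<And>j. j \<in> J \<Longrightarrow> A j \<subseteq> U" "\<And>j l. j \<in> J \<Longrightarrow> l \<in> J \<Longrightarrow> j \<noteq> l \<Longrightarrow> A j \<inter> A l = {}"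
    and "\<And>j. j \<in> J \<Longrightarrow> vanishing_ideal (A j) (X j) \<subseteq> Q"
  shows "vanishing_ideal (\<Union>j\<in>J. A j) {x. \<forall>j\<in>J. \<exists>y\<in>X j. \<forall>i\<in>A j. x i = y i} \<subseteq> Q"
  using assms(2-)
proof (induction J rule: finite_induct)
  case empty
  \<comment> \<open>A polynomial without variables that has a zero is the zero polynomial.\<close>
  have "f = 0" if f: "indets f = {}" "\<forall>x. eval_poly x f = 0" for f :: "'a cpoly"
  proof -
    have keys: "Poly_Mapping.keys f \<subseteq> {0}"
      using f(1) by (auto simp: indets_def)
    then have "eval_poly (\<lambda>_. 0) f = Poly_Mapping.lookup f 0"
      by (subst eval_poly_superset[of "{0}"]) (simp_all add: monom_value_def)
    with f(2) have "0 \<notin> Poly_Mapping.keys f"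
      by (simp add: in_keys_iff)
    with keys have "Poly_Mapping.keys f = {}" by blast
    then show ?thesis by simp
  qed
  then show ?case
    using ideal_0[OF Q] by (fastforce simp: vanishing_ideal_iff)
next
  case (insert j J)
  let ?Y = "{x. \<forall>j\<in>J. \<exists>y\<in>X j. \<forall>i\<in>A j. x i = y i}"
  have disj: "A j \<inter> (\<Union>j\<in>J. A j) = {}"
    using insert.prems(2)[of j] insert.hyps by blast
  show ?case
  proof
    fix f assume f: "f \<in> vanishing_ideal (\<Union>j\<in>insert j J. A j)
      {x. \<forall>j\<in>insert j J. \<exists>y\<in>X j. \<forall>i\<in>A j. x i = y i}"
    show "f \<in> Q"
    proof (rule vanishing_on_product_in_ideal[OF Q _ _ disj])
      show "vanishing_ideal (\<Union>j\<in>J. A j) ?Y \<subseteq> Q"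
        by (rule insert.IH) (use insert.prems in auto)
      show "indets f \<subseteq> A j \<union> (\<Union>j\<in>J. A j)"
        using f by (simp add: vanishing_ideal_iff)
      fix x y assume xy: "x \<in> X j" "y \<in> ?Y"
      let ?z = "\<lambda>i. if i \<in> A j then x i else y i"
      have "\<exists>y\<in>X l. \<forall>i\<in>A l. ?z i = y i" if "l \<in> insert j J" for l
      proof (cases "l = j")
        case True
        then show ?thesis using xy by auto
      next
        case False
        then have "l \<in> J" using that by simp
        then obtain w where "w \<in> X l" "\<forall>i\<in>A l. y i = w i" using xy by blast
        moreover have "\<forall>i\<in>A l. i \<notin> A j" using disj \<open>l \<in> J\<close> by blast
        ultimately show ?thesis by auto
      qed
      then show "eval_poly ?z f = 0"
        using f unfolding vanishing_ideal_iff by blast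
    qed (use insert.prems in auto)
  qed
qed

section \<open>Tensors of bounded rank\<close>

text \<open>
  Over finite index sets the unit tensors show that a decomposition exists, so that the rank is
  attained; a shorter decomposition is padded with zero summands, which are products because
  there is at least one factor.
\<close>

lemma tensor_rank_le_imp_decomposition:
  assumes fin: "\<And>s. s \<in> {1..k} \<Longrightarrow> finite (J s)" and k: "k \<ge> 1"
    and le: "tensor_rank k J T \<le> r"
  shows "\<exists>a. \<forall>i\<in>(\<Pi>\<^sub>E s\<in>{1..k}. J s). T i = (\<Sum>l<r. \<Prod>s=1..k. a l s (i s))"
proof -
  let ?I = "\<Pi>\<^sub>E s\<in>{1..k}. J s"
  let ?P = "\<lambda>n. \<exists>a. \<forall>i\<in>?I. T i = (\<Sum>l<n. \<Prod>s=1..k. a l s (i s))"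
  have finI: "finite ?I" using fin by (intro finite_PiE) auto
  then obtain w n where w: "bij_betw w {..<n :: nat} ?I"
    using ex_bij_betw_nat_finite by (metis lessThan_atLeast0)
  have "?P n"
  proof (intro exI ballI)
    \<comment> \<open>Summand \<open>l\<close> is the unit tensor at \<open>w l\<close>; its first factor carries the entry of \<open>T\<close>.\<close>
    let ?a = "\<lambda>l s u. (if s = 1 then T (w l) else 1) * (if u = w l s then 1 else 0)"
    fix i assume i: "i \<in> ?I"
    have "(\<Prod>s=1..k. ?a l s (i s)) = (if w l = i then T i else 0)" if "l < n" for l
    proof (cases "w l = i")
      case True
      then have "(\<Prod>s=1..k. ?a l s (i s)) = (\<Prod>s=1..k. if s = 1 then T i else 1)"
        by simp
      also have "\<dots> = T i" using k by (subst prod.delta) auto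
      finally show ?thesis using True by simp
    next
      case False
      have "w l \<in> ?I" using w that by (auto simp: bij_betw_def)
      then obtain s where "s \<in> {1..k}" "i s \<noteq> w l s"
        using False i by (metis PiE_ext)
      then have "(\<Prod>s=1..k. ?a l s (i s)) = 0"
        by (intro prod_zero bexI[of _ s]) auto
      then show ?thesis using False by simp
    qed
    then have "(\<Sum>l<n. \<Prod>s=1..k. ?a l s (i s)) = (\<Sum>l<n. if w l = i then T i else 0)"
      by (intro sum.cong) auto
    also have "\<dots> = (\<Sum>v\<in>?I. if v = i then T i else 0)"
      by (rule sum.reindex_bij_betw[OF w, of "\<lambda>v. if v = i then T i else 0"])
    also have "\<dots> = T i" using finI i by simp
    finally show "T i = (\<Sum>l<n. \<Prod>s=1..k. ?a l s (i s))" by simp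
  qed
  then have "?P (tensor_rank k J T)"
    unfolding tensor_rank_def by (rule LeastI)
  then obtain a where
    a: "\<And>i. i \<in> ?I \<Longrightarrow> T i = (\<Sum>l<tensor_rank k J T. \<Prod>s=1..k. a l s (i s))"
    by blast
  let ?b = "\<lambda>l s u. if l < tensor_rank k J T then a l s u else 0"
  have "T i = (\<Sum>l<r. \<Prod>s=1..k. ?b l s (i s))" if "i \<in> ?I" for i
  proof -
    have "(\<Sum>l<r. \<Prod>s=1..k. ?b l s (i s)) = (\<Sum>l<tensor_rank k J T. \<Prod>s=1..k. ?b l s (i s))"
      by (rule sum.mono_neutral_right) (use le k in auto)
    then show ?thesis using a[OF that] by simp
  qed
  then show "?P r" by (intro exI[of _ ?b]) blast
qed

section \<open>The slices of the graphical model\<close>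

lemma clique_star_ge_1:
  assumes "clique_star V E k K S"
  shows "k \<ge> 1"
proof (rule ccontr)
  assume "\<not> k \<ge> 1"
  then have "maximal_cliques V E = {}" "V = {}"
    using assms by (auto simp: clique_star_def bij_betw_def)
  moreover have "{} \<in> maximal_cliques {} E"
    by (auto simp: maximal_cliques_def clique_def)
  ultimately show False by simp
qed

lemma clique_star_core_subset:
  assumes "clique_star V E k K S" "s \<in> {1..k}"
  shows "S \<subseteq> K s"
proof (cases "k = 1")
  case True
  \<comment> \<open>Here there are no intersections to use: \<open>S\<close> is an arbitrary clique of a complete graph.\<close>
  with assms have "V = K s" by (auto simp: clique_star_def)
  then show ?thesis using assms by (auto simp: clique_star_def clique_def)
next
  case False
  then obtain l where "l \<in> {1..k}" "s \<noteq> l"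
    using assms(2) by (intro that[of "if s = 1 then 2 else 1"]) auto
  then have "K s \<inter> K l = S" using assms unfolding clique_star_def by blast
  then show ?thesis by blast
qed

lemma graph_map_clique_star:
  assumes "clique_star V E k K S" "i \<in> states d V"
  shows "graph_map V E d \<theta> i = (\<Prod>s=1..k. \<theta> (K s) (restrict i (K s)))"
proof -
  have "bij_betw K {1..k} (maximal_cliques V E)"
    using assms(1) unfolding clique_star_def by blast
  then show ?thesis
    using assms(2) prod.reindex_bij_betw[of K "{1..k}" _ "\<lambda>C. \<theta> C (restrict i C)"]
    by (simp add: graph_map_def)
qed

definition graph_secant_points ::
    "'v set \<Rightarrow> 'v set set \<Rightarrow> ('v \<Rightarrow> nat) \<Rightarrow> nat \<Rightarrow> (('v \<Rightarrow> nat) \<Rightarrow> complex) set" where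
  "graph_secant_points V E d r =
     {\<lambda>i\<in>states d V. \<Sum>l<r. x l i | x. \<forall>l<r. x l \<in> range (graph_map V E d)}"

definition rank_le_points ::
    "'v set \<Rightarrow> ('v \<Rightarrow> nat) \<Rightarrow> nat \<Rightarrow> (nat \<Rightarrow> 'v set) \<Rightarrow> 'v set \<Rightarrow> nat \<Rightarrow> ('v \<Rightarrow> nat) \<Rightarrow>
     (('v \<Rightarrow> nat) \<Rightarrow> complex) set" where
  "rank_le_points V d k C S r j =
     {\<lambda>i\<in>slice V d S j. T (\<lambda>s\<in>{1..k}. restrict i (C s)) | T.
        tensor_rank k (\<lambda>s. states d (C s)) T \<le> r}"

context
  fixes V :: "'v set" and E :: "'v set set" and d :: "'v \<Rightarrow> nat"
    and k r :: nat and K :: "nat \<Rightarrow> 'v set" and S :: "'v set"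
  assumes graph: "simple_graph V E" and star: "clique_star V E k K S"
begin

lemma clique_subset: "s \<in> {1..k} \<Longrightarrow> K s \<subseteq> V"
  using star by (auto simp: clique_star_def)

lemma core_subset: "S \<subseteq> V"
  using star unfolding clique_star_def clique_def by blast

lemma finite_states: "A \<subseteq> V \<Longrightarrow> finite (states d A)"
  using graph finite_subset by (auto simp: states_def simple_graph_def intro!: finite_PiE)

lemma restrict_states: "i \<in> states d V \<Longrightarrow> A \<subseteq> V \<Longrightarrow> restrict i A \<in> states d A"
  by (auto simp: states_def)

lemma slices_cover: "(\<Union>j\<in>states d S. slice V d S j) = states d V"
  using restrict_states[OF _ core_subset] by (auto simp: slice_def)

lemma tensor_index:
  "i \<in> states d V \<Longrightarrow>
    (\<lambda>s\<in>{1..k}. restrict i (K s - S)) \<in> (\<Pi>\<^sub>E s\<in>{1..k}. states d (K s - S))"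
  using clique_subset by (intro restrict_PiE_iff[THEN iffD2] ballI restrict_states) blast+

text \<open>
  Freezing the core at \<open>j\<close> turns the parameters of a clique \<open>K s\<close> into a vector indexed by the states
  of \<open>K s - S\<close>, and these vectors are the factors of a product tensor.
\<close>

lemma graph_secant_slice_rank_le:
  assumes x: "x \<in> graph_secant_points V E d r"
  shows "\<exists>y\<in>rank_le_points V d k (\<lambda>s. K s - S) S r j. \<forall>i\<in>slice V d S j. x i = y i"
proof -
  obtain p where p: "x = (\<lambda>i\<in>states d V. \<Sum>l<r. p l i)"
    and "\<forall>l<r. p l \<in> range (graph_map V E d)"
    using x by (auto simp: graph_secant_points_def)
  then have "\<forall>l. \<exists>\<theta>. l < r \<longrightarrow> p l = graph_map V E d \<theta>" by blast
  then obtain \<theta> where \<theta>: "\<And>l. l < r \<Longrightarrow> p l = graph_map V E d (\<theta> l)" by metis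
  define a where
    "a l s u = \<theta> l (K s) (\<lambda>v\<in>K s. if v \<in> S then j v else u v)" for l s u
  define T where "T t = (\<Sum>l<r. \<Prod>s=1..k. a l s (t s))" for t
  have "tensor_rank k (\<lambda>s. states d (K s - S)) T \<le> r"
    unfolding tensor_rank_def by (rule Least_le) (auto simp: T_def)
  then have "(\<lambda>i\<in>slice V d S j. T (\<lambda>s\<in>{1..k}. restrict i (K s - S)))
      \<in> rank_le_points V d k (\<lambda>s. K s - S) S r j"
    by (auto simp: rank_le_points_def)
  moreover have "x i = T (\<lambda>s\<in>{1..k}. restrict i (K s - S))" if i: "i \<in> slice V d S j" for i
  proof -
    have iV: "i \<in> states d V" and ij: "restrict i S = j" using i by (auto simp: slice_def)
    have "restrict i (K s) = (\<lambda>v\<in>K s. if v \<in> S then j v else restrict i (K s - S) v)" for s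
      using ij by auto
    then have "a l s (restrict i (K s - S)) = \<theta> l (K s) (restrict i (K s))" for l s
      by (simp add: a_def)
    then show ?thesis
      using iV by (simp add: p T_def \<theta> graph_map_clique_star[OF star])
  qed
  ultimately show ?thesis by (intro bexI) auto
qed

text \<open>
  Conversely, a parameter index of a clique contains the state \<open>j\<close> of the core, so that factors chosen
  independently for the different slices are values of one common parameter.
\<close>

lemma rank_le_slices_imp_graph_secant:
  assumes x: "\<And>j. j \<in> states d S \<Longrightarrow>
    \<exists>y\<in>rank_le_points V d k (\<lambda>s. K s - S) S r j. \<forall>i\<in>slice V d S j. x i = y i"
  shows "\<exists>y\<in>graph_secant_points V E d r. \<forall>i\<in>states d V. x i = y i"
proof -
  have "\<exists>a. \<forall>i\<in>slice V d S j. x i = (\<Sum>l<r. \<Prod>s=1..k. a l s (restrict i (K s - S)))"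
    if j: "j \<in> states d S" for j
  proof -
    obtain T where T: "tensor_rank k (\<lambda>s. states d (K s - S)) T \<le> r"
      and xT: "\<forall>i\<in>slice V d S j. x i = T (\<lambda>s\<in>{1..k}. restrict i (K s - S))"
      using x[OF j] by (auto simp: rank_le_points_def)
    have "finite (states d (K s - S))" if "s \<in> {1..k}" for s
      using clique_subset[OF that] by (intro finite_states) auto
    from tensor_rank_le_imp_decomposition[OF this clique_star_ge_1[OF star] T] obtain a where
      a: "\<forall>t\<in>(\<Pi>\<^sub>E s\<in>{1..k}. states d (K s - S)). T t = (\<Sum>l<r. \<Prod>s=1..k. a l s (t s))"
      by blast
    have "x i = (\<Sum>l<r. \<Prod>s=1..k. a l s (restrict i (K s - S)))" if i: "i \<in> slice V d S j" for i
    proof -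
      have "i \<in> states d V" using i by (simp add: slice_def)
      then show ?thesis
        using xT i bspec[OF a tensor_index] by simp
    qed
    then show ?thesis by blast
  qed
  then have "\<forall>j\<in>states d S. \<exists>a. \<forall>i\<in>slice V d S j.
      x i = (\<Sum>l<r. \<Prod>s=1..k. a l s (restrict i (K s - S)))"
    by (rule ballI)
  from bchoice[OF this] obtain a where a: "\<forall>j\<in>states d S. \<forall>i\<in>slice V d S j.
      x i = (\<Sum>l<r. \<Prod>s=1..k. a j l s (restrict i (K s - S)))"
    by (rule exE)
  \<comment> \<open>For a clique \<open>C = K s\<close> the inverse of \<open>K\<close> recovers \<open>s\<close>; the part of the index \<open>w\<close> on the core
    selects the slice.\<close>
  define \<theta> where
    "\<theta> l C w = a (restrict w S) l (the_inv_into {1..k} K C) (restrict w (C - S))" for l C w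
  have inj: "inj_on K {1..k}"
    using star by (auto simp: clique_star_def bij_betw_def)
  have "x i = (\<Sum>l<r. graph_map V E d (\<theta> l) i)" if i: "i \<in> states d V" for i
  proof -
    have "\<theta> l (K s) (restrict i (K s)) = a (restrict i S) l s (restrict i (K s - S))"
      if s: "s \<in> {1..k}" for l s
    proof -
      have "K s \<inter> S = S" "K s \<inter> (K s - S) = K s - S"
        using clique_star_core_subset[OF star s] by auto
      moreover have "the_inv_into {1..k} K (K s) = s"
        using inj s by (rule the_inv_into_f_f)
      ultimately show ?thesis
        by (simp only: \<theta>_def restrict_restrict)
    qed
    then show ?thesis
      using bspec[OF bspec[OF a restrict_states[OF i core_subset]], of i] i
      by (simp add: slice_def graph_map_clique_star[OF star])
  qed
  moreover have "(\<lambda>i\<in>states d V. \<Sum>l<r. graph_map V E d (\<theta> l) i) \<in> graph_secant_points V E d r"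
    unfolding graph_secant_points_def
    by (rule CollectI, rule exI[of _ "\<lambda>l. graph_map V E d (\<theta> l)"]) auto
  ultimately show ?thesis by (intro bexI) auto
qed

end

section \<open>The secant ideal of a clique star\<close>

theorem theorem3p7:
  fixes V :: "'v set" and E :: "'v set set" and d :: "'v \<Rightarrow> nat"
    and k r :: nat and K :: "nat \<Rightarrow> 'v set" and S :: "'v set"
  assumes "simple_graph V E"
    and "\<forall>v\<in>V. d v \<ge> 1"
    and "clique_star V E k K S"
    and "r \<ge> 1"
  shows "graph_secant_ideal V E d r =
    (\<Sum>j\<in>states d S.
       Idl\<^bsub>mpoly_ring (states d V)\<^esub> (independence_secant_ideal V d k (\<lambda>i. K i - S) S r j))"
proof -
  note graph = assms(1) and star = assms(3)
  let ?R = "mpoly_ring (states d V)"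
  let ?X = "rank_le_points V d k (\<lambda>i. K i - S) S r"
  let ?I = "\<lambda>j. independence_secant_ideal V d k (\<lambda>i. K i - S) S r j"
  let ?Q = "\<Sum>j\<in>states d S. Idl\<^bsub>?R\<^esub> (?I j)"
  have GI: "graph_secant_ideal V E d r = vanishing_ideal (states d V) (graph_secant_points V E d r)"
    by (simp add: graph_secant_ideal_def graph_secant_points_def)
  have II: "?I j = vanishing_ideal (slice V d S j) (?X j)" for j
    by (simp add: independence_secant_ideal_def rank_le_points_def)
  have fin: "finite (states d S)"
    by (rule finite_states[OF graph star core_subset[OF graph star]])
  have slice_sub: "slice V d S j \<subseteq> states d V" for j
    by (auto simp: slice_def)
  have I_carrier: "?I j \<subseteq> carrier ?R" for j
    using slice_sub[of j] unfolding II by (fastforce simp: vanishing_ideal_iff carrier_mpoly_ring)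
  have ideals: "ideal (Idl\<^bsub>?R\<^esub> (?I j)) ?R" for j
    by (rule ring.genideal_ideal[OF ring_mpoly_ring I_carrier])
  have idQ: "ideal ?Q ?R"
    by (rule ideal_sum_ideals[OF fin ideals])
  show ?thesis
  proof
    show "?Q \<subseteq> graph_secant_ideal V E d r"
      unfolding GI
    proof (rule sum_ideals_subset[OF fin ideal_vanishing_ideal])
      fix j
      show "Idl\<^bsub>?R\<^esub> (?I j) \<subseteq> vanishing_ideal (states d V) (graph_secant_points V E d r)"
      proof (rule ring.genideal_minimal[OF ring_mpoly_ring ideal_vanishing_ideal], rule subsetI)
        fix f assume f: "f \<in> ?I j"
        have "eval_poly x f = 0" if x: "x \<in> graph_secant_points V E d r" for x
        proof -
          obtain y where y: "y \<in> ?X j" "\<forall>i\<in>slice V d S j. x i = y i"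
            using graph_secant_slice_rank_le[OF graph star x] by blast
          then have "eval_poly x f = eval_poly y f"
            using f by (intro eval_poly_cong) (auto simp: II vanishing_ideal_iff)
          then show ?thesis
            using f y by (simp add: II vanishing_ideal_iff)
        qed
        then show "f \<in> vanishing_ideal (states d V) (graph_secant_points V E d r)"
          using subsetD[OF I_carrier f] by (simp add: vanishing_ideal_iff carrier_mpoly_ring)
      qed
    qed
    let ?P = "{x. \<forall>j\<in>states d S. \<exists>y\<in>?X j. \<forall>i\<in>slice V d S j. x i = y i}"
    have "graph_secant_ideal V E d r \<subseteq> vanishing_ideal (\<Union>j\<in>states d S. slice V d S j) ?P"
    proof
      fix f assume f: "f \<in> graph_secant_ideal V E d r"
      have "eval_poly x f = 0" if x: "x \<in> ?P" for x
      proof -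
        from x have "\<exists>y\<in>?X j. \<forall>i\<in>slice V d S j. x i = y i" if "j \<in> states d S" for j
          using that by simp
        from rank_le_slices_imp_graph_secant[OF graph star this]
        obtain y where y: "y \<in> graph_secant_points V E d r" "\<forall>i\<in>states d V. x i = y i"
          by (rule bexE)
        then have "eval_poly x f = eval_poly y f"
          using f by (intro eval_poly_cong) (auto simp: GI vanishing_ideal_iff)
        then show ?thesis
          using f y by (simp add: GI vanishing_ideal_iff)
      qed
      then show "f \<in> vanishing_ideal (\<Union>j\<in>states d S. slice V d S j) ?P"
        using f unfolding GI vanishing_ideal_iff slices_cover[OF graph star] by blast
    qed
    also have "\<dots> \<subseteq> ?Q"
    proof (rule vanishing_ideal_product_subset[OF idQ fin slice_sub])
      show "slice V d S j \<inter> slice V d S l = {}" if "j \<noteq> l" for j l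
        using that by (auto simp: slice_def)
      fix j assume j: "j \<in> states d S"
      have "?I j \<subseteq> Idl\<^bsub>?R\<^esub> (?I j)"
        by (rule ring.genideal_self[OF ring_mpoly_ring I_carrier])
      also have "\<dots> \<subseteq> ?Q"
        by (rule summand_subset_sum_ideals[OF fin ideals j])
      finally show "vanishing_ideal (slice V d S j) (?X j) \<subseteq> ?Q"
        by (simp add: II)
    qed
    finally show "graph_secant_ideal V E d r \<subseteq> ?Q" .
  qed
qed

end
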